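(* For all connected graphs $G$ and $H$ on $n$ vertices, either $X_G-X_H=0$ or $X_G-X_H$ is not Schur-positive.
   Context: All graphs are finite and simple. The chromatic symmetric function of a graph $G$ with vertices $v_1,\dots,v_n$ is $X_G=\sum_{\kappa}x_{\kappa(v_1)}\cdots x_{\kappa(v_n)}$, summed over all proper colorings $\kappa:V(G)\to\{1,2,3,\dots\}$ (adjacent vertices get different colors); it is a homogeneous symmetric function of degree $n$ in commuting variables $x_1,x_2,\dots$ over $\mathbb{Q}$. A symmetric function is Schur-positive if it is a linear combination of Schur symmetric functions $s_\lambda$ with non-negative coefficients. *)

theory Defs
  imports
    "Graph_Theory.Digraph_Component"
    "HOL.Rat"
    "HOL-Library.FuncSet"
    "HOL-Library.Multiset"
    "HOL-Library.Function_Algebras"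
begin

text \<open>
  A monomial in the variables \<open>x\<^sub>1, x\<^sub>2, \<dots>\<close> is the multiset of the indices of its
  factors, so \<open>x\<^sub>1\<^sup>2 x\<^sub>3\<close> is \<open>{#1, 1, 3#}\<close>; the index 0 is never used. A formal power
  series is the function sending a monomial to its coefficient. Only the pointwise
  operations \<open>+\<close>, \<open>-\<close>, \<open>0\<close> on functions are used (the pointwise product is not the
  product of power series).
\<close>

type_synonym series = "nat multiset \<Rightarrow> rat"

text \<open>
  The series summing, over all \<open>a \<in> A\<close>, the monomial \<open>w a\<close>. It is meaningful if only
  finitely many members of \<open>A\<close> have a given monomial, since \<^const>\<open>card\<close> is 0 on
  infinite sets.
\<close>

definition monomial_sum :: "('a \<Rightarrow> nat multiset) \<Rightarrow> 'a set \<Rightarrow> series" where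
  "monomial_sum w A = (\<lambda>m. of_nat (card {a \<in> A. w a = m}))"

text \<open>
  Finite simple graphs are those satisfying the predicate \<^locale>\<open>graph\<close>: finite symmetric
  digraphs without loops and parallel arcs, each edge being a pair of opposite arcs.
  Colorings are extensional, so that there is exactly one function per coloring of the
  vertices.
\<close>

definition proper_colorings :: "('a, 'b) pre_digraph \<Rightarrow> ('a \<Rightarrow> nat) set" where
  "proper_colorings G =
     {\<kappa> \<in> verts G \<rightarrow>\<^sub>E {1..}. \<forall>u v. u \<rightarrow>\<^bsub>G\<^esub> v \<longrightarrow> \<kappa> u \<noteq> \<kappa> v}"

definition chromatic_symmetric_function :: "('a, 'b) pre_digraph \<Rightarrow> series" where
  "chromatic_symmetric_function G =
     monomial_sum (\<lambda>\<kappa>. image_mset \<kappa> (mset_set (verts G))) (proper_colorings G)"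

definition is_partition :: "nat list \<Rightarrow> bool" where
  "is_partition l \<longleftrightarrow> sorted_wrt (\<ge>) l \<and> (\<forall>p \<in> set l. p > 0)"

text \<open>The cell \<open>(i, j)\<close> lies in row \<open>i\<close> and column \<open>j\<close>, both counted from 0.\<close>

definition cells :: "nat list \<Rightarrow> (nat \<times> nat) set" where
  "cells l = {(i, j). i < length l \<and> j < l ! i}"

definition semistandard_tableaux :: "nat list \<Rightarrow> (nat \<times> nat \<Rightarrow> nat) set" where
  "semistandard_tableaux l =
     {T \<in> cells l \<rightarrow>\<^sub>E {1..}.
        (\<forall>i j j'. (i, j) \<in> cells l \<longrightarrow> (i, j') \<in> cells l \<longrightarrow> j < j' \<longrightarrow> T (i, j) \<le> T (i, j')) \<and>
        (\<forall>i i' j. (i, j) \<in> cells l \<longrightarrow> (i', j) \<in> cells l \<longrightarrow> i < i' \<longrightarrow> T (i, j) < T (i', j))}"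

definition schur :: "nat list \<Rightarrow> series" where
  "schur l = monomial_sum (\<lambda>T. image_mset T (mset_set (cells l))) (semistandard_tableaux l)"

definition schur_positive :: "series \<Rightarrow> bool" where
  "schur_positive f \<longleftrightarrow>
     (\<exists>P c. finite P \<and> (\<forall>l \<in> P. is_partition l \<and> c l \<ge> 0) \<and>
        f = (\<Sum>l \<in> P. (\<lambda>m. c l * schur l m)))"

text \<open>The sums of monomials above are meaningful, because each monomial occurs finitely often.\<close>

lemma finite_fillings_with_monomial:
  assumes "finite S"
  shows "finite {f \<in> S \<rightarrow>\<^sub>E A. image_mset f (mset_set S) = m}"
proof (rule finite_subset)
  show "{f \<in> S \<rightarrow>\<^sub>E A. image_mset f (mset_set S) = m} \<subseteq> S \<rightarrow>\<^sub>E set_mset m"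
    using assms by (auto simp: PiE_iff extensional_def)
  show "finite (S \<rightarrow>\<^sub>E set_mset m)"
    using assms by (simp add: finite_PiE)
qed

lemma finite_proper_colorings_with_monomial:
  assumes "finite (verts G)"
  shows "finite {\<kappa> \<in> proper_colorings G. image_mset \<kappa> (mset_set (verts G)) = m}"
  by (rule finite_subset[OF _ finite_fillings_with_monomial[OF assms, of "{1..}" m]])
     (auto simp: proper_colorings_def)

lemma finite_cells: "finite (cells l)"
proof -
  have "cells l = Sigma {..<length l} (\<lambda>i. {..<l ! i})"
    by (auto simp: cells_def)
  then show ?thesis by simp
qed

lemma finite_tableaux_with_monomial:
  "finite {T \<in> semistandard_tableaux l. image_mset T (mset_set (cells l)) = m}"
  by (rule finite_subset[OF _ finite_fillings_with_monomial[OF finite_cells, of l "{1..}" m]])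
     (auto simp: semistandard_tableaux_def)

end

theory Submission
  imports Defs "HOL-Library.Product_Lexorder"
begin

text \<open>
  The coefficient of \<open>x\<^sub>1 \<cdots> x\<^sub>k\<close> in a chromatic symmetric function counts the bijective colorings,
  all of which are proper, so it depends only on the number of vertices and cancels in the
  difference. In a Schur function of degree \<open>k\<close> the same coefficient counts the standard Young
  tableaux, of which there is at least one. Hence in a non-negative combination of Schur functions
  equal to the difference every coefficient vanishes.
\<close>

text \<open>Comparing supports gives surjectivity onto \<open>B\<close>, comparing sizes gives
  \<open>card A = card B\<close>, and between finite sets of equal size a surjection is
  injective.\<close>

lemma image_mset_mset_set_eq_mset_set_iff:
  assumes "finite A" and "finite B"
  shows "image_mset f (mset_set A) = mset_set B \<longleftrightarrow> bij_betw f A B"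
proof
  assume eq: "image_mset f (mset_set A) = mset_set B"
  have "f ` A = B"
    using arg_cong[OF eq, of set_mset] assms by simp
  moreover have "card A = card B"
    using arg_cong[OF eq, of size] by simp
  ultimately show "bij_betw f A B"
    using assms by (auto simp: bij_betw_def intro: eq_card_imp_inj_on)
next
  assume "bij_betw f A B"
  then show "image_mset f (mset_set A) = mset_set B"
    by (auto simp: bij_betw_def image_mset_mset_set)
qed

text \<open>Lets bijective colorings of two graphs be compared although their vertices may have
  different types.\<close>

lemma card_extensional_bijections_cong:
  assumes "finite A" and "finite B" and "card A = card B"
  shows "card {f \<in> extensional A. bij_betw f A C} = card {f \<in> extensional B. bij_betw f B C}"
proof -
  obtain h where h: "bij_betw h A B"
    using assms finite_same_card_bij by blast
  let ?g = "the_inv_into A h"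
  have g: "bij_betw ?g B A"
    using h by (rule bij_betw_the_inv_into)
  have hg: "h (?g b) = b" "?g b \<in> A" if "b \<in> B" for b
    using that h g by (auto simp: bij_betw_def f_the_inv_into_f)
  have gh: "?g (h a) = a" "h a \<in> B" if "a \<in> A" for a
    using that h by (auto simp: bij_betw_def the_inv_into_f_f)
  \<comment> \<open>Relabelling along \<open>h\<close>: precomposition with its inverse
    \<open>?g\<close> is undone by precomposition with \<open>h\<close>. The restrictions keep the
    results extensional.\<close>
  have "bij_betw (\<lambda>f. restrict (\<lambda>b. f (?g b)) B)
      {f \<in> extensional A. bij_betw f A C} {f \<in> extensional B. bij_betw f B C}"
    by (rule bij_betw_byWitness[where f' = "\<lambda>f. restrict (\<lambda>a. f (h a)) A"])
      (auto simp: hg gh extensional_def fun_eq_iff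
        dest: bij_betw_trans[OF g, unfolded comp_def] bij_betw_trans[OF h, unfolded comp_def])
  then show ?thesis
    by (rule bij_betw_same_card)
qed

lemma ex_strict_mono_on_bij_betw_card:
  fixes A :: "'a :: linorder set"
  assumes "finite A"
  shows "\<exists>f. strict_mono_on A f \<and> bij_betw f A {1..card A}"
proof -
  \<comment> \<open>The rank of \<open>a\<close> in \<open>A\<close>; it counts \<open>a\<close>
    itself, so ranks start at 1.\<close>
  let ?f = "\<lambda>a. card {b \<in> A. b \<le> a}"
  have mono: "strict_mono_on A ?f"
  proof (rule strict_mono_onI)
    fix a b assume "a \<in> A" "b \<in> A" "a < b"
    then have "b \<in> {c \<in> A. c \<le> b} - {c \<in> A. c \<le> a}" "{c \<in> A. c \<le> a} \<subseteq> {c \<in> A. c \<le> b}"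
      by auto
    then show "?f a < ?f b"
      using assms by (intro psubset_card_mono) auto
  qed
  have "?f ` A \<subseteq> {1..card A}"
    using assms by (auto simp: Suc_le_eq card_gt_0_iff intro!: card_mono)
  moreover have inj: "inj_on ?f A"
    using mono by (rule strict_mono_on_imp_inj_on)
  ultimately have "?f ` A = {1..card A}"
    by (intro card_subset_eq) (simp_all add: card_image)
  with mono inj show ?thesis
    by (auto simp: bij_betw_def)
qed

lemma coeff_chromatic_symmetric_function:
  assumes "graph G"
  shows "chromatic_symmetric_function G (mset_set {1..k}) =
    of_nat (card {\<kappa> \<in> extensional (verts G). bij_betw \<kappa> (verts G) {1..k}})"
proof -
  interpret graph G by fact
  have "\<kappa> \<in> proper_colorings G \<and> image_mset \<kappa> (mset_set (verts G)) = mset_set {1..k} \<longleftrightarrow>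
      \<kappa> \<in> extensional (verts G) \<and> bij_betw \<kappa> (verts G) {1..k}" for \<kappa>
  proof -
    have "\<kappa> \<in> proper_colorings G"
      if "\<kappa> \<in> extensional (verts G)" and bij: "bij_betw \<kappa> (verts G) {1..k}"
    proof -
      \<comment> \<open>There are no loops, so adjacent vertices are distinct and injectivity
        separates their colors.\<close>
      have "\<kappa> u \<noteq> \<kappa> v" if "u \<rightarrow>\<^bsub>G\<^esub> v" for u v
        using that bij adj_not_same adj_in_verts
        by (metis bij_betw_def inj_onD)
      moreover have "\<kappa> \<in> verts G \<rightarrow>\<^sub>E {1..}"
        using that by (auto simp: PiE_iff bij_betw_def)
      ultimately show ?thesis
        by (simp add: proper_colorings_def)
    qed
    then show ?thesis
      by (auto simp: image_mset_mset_set_eq_mset_set_iff proper_colorings_def PiE_iff)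
  qed
  then show ?thesis
    by (simp add: chromatic_symmetric_function_def monomial_sum_def)
qed

lemma coeff_schur_pos: "schur l (mset_set {1..card (cells l)}) > 0"
proof -
  \<comment> \<open>Increasing for the lexicographic order of the cells means filling the diagram row by row.\<close>
  obtain T where mono: "strict_mono_on (cells l) T"
    and bij: "bij_betw T (cells l) {1..card (cells l)}"
    using ex_strict_mono_on_bij_betw_card[OF finite_cells] by blast
  let ?T = "restrict T (cells l)"
  \<comment> \<open>A step to the right within a row and a step down within a column both go up in
    the lexicographic order, so \<open>T\<close> increases along each.\<close>
  have "?T \<in> semistandard_tableaux l"
    using bij strict_mono_onD[OF mono]
    by (auto simp: semistandard_tableaux_def bij_betw_def less_imp_le)
  moreover have "image_mset ?T (mset_set (cells l)) = mset_set {1..card (cells l)}"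
    using bij by (simp add: image_mset_mset_set_eq_mset_set_iff finite_cells del: One_nat_def)
  ultimately show ?thesis
    using finite_tableaux_with_monomial[of l "mset_set {1..card (cells l)}"]
    by (auto simp: schur_def monomial_sum_def card_gt_0_iff)
qed

theorem theorem2p15:
  fixes G :: "('a, 'b) pre_digraph" and H :: "('c, 'd) pre_digraph" and n :: nat
  assumes "graph G" and "Digraph_Component.connected G" and "card (verts G) = n"
    and "graph H" and "Digraph_Component.connected H" and "card (verts H) = n"
  shows "chromatic_symmetric_function G - chromatic_symmetric_function H = 0 \<or>
    \<not> schur_positive (chromatic_symmetric_function G - chromatic_symmetric_function H)"
proof -
  let ?D = "chromatic_symmetric_function G - chromatic_symmetric_function H"
  interpret G: graph G by fact
  interpret H: graph H by fact
  \<comment> \<open>Needed for every \<open>k\<close>, since the partitions in \<open>P\<close>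
    below may have any size.\<close>
  have D0: "?D (mset_set {1..k}) = 0" for k
    using card_extensional_bijections_cong[of "verts G" "verts H" "{1..k}"] assms
    by (simp add: coeff_chromatic_symmetric_function del: One_nat_def)
  have "?D = 0" if "schur_positive ?D"
  proof -
    from that obtain P c where P: "finite P" and c: "\<forall>l \<in> P. c l \<ge> 0"
      and D: "?D = (\<Sum>l \<in> P. (\<lambda>m. c l * schur l m))"
      by (auto simp: schur_positive_def)
    have sum_app: "(\<Sum>l \<in> P. (\<lambda>m. c l * schur l m)) m = (\<Sum>l \<in> P. c l * schur l m)" for m
      by (induction P rule: infinite_finite_induct) auto
    have "c l = 0" if "l \<in> P" for l
    proof -
      \<comment> \<open>The squarefree monomial of the degree of \<open>schur l\<close>: there the
        terms are non-negative with sum 0, so each is 0, while the coefficient of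
        \<open>schur l\<close> is positive.\<close>
      let ?m = "mset_set {1..card (cells l)}"
      have "(\<Sum>l' \<in> P. c l' * schur l' ?m) = 0"
        using D0[of "card (cells l)"] unfolding D sum_app .
      moreover have "c l' * schur l' ?m \<ge> 0" if "l' \<in> P" for l'
        using that c by (simp add: schur_def monomial_sum_def)
      ultimately have "c l * schur l ?m = 0"
        using \<open>l \<in> P\<close> P by (simp add: sum_nonneg_eq_0_iff)
      with coeff_schur_pos[of l] show ?thesis
        by simp
    qed
    then show ?thesis
      unfolding D by (simp add: fun_eq_iff sum_app)
  qed
  then show ?thesis
    by blast
qed

end
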